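(* Let $\mathbf{k}$ be a field, let $V=\mathbf{k}\{\prec,\succ,\bullet\}$ be the $\mathbf{k}$-vector space with basis $\{\prec,\succ,\bullet\}$, and let $\mathcal{P}=\mathcal{P}(V)/(R)$ be a binary quadratic nonsymmetric operad with relation space $R\subseteq V^{\otimes2}\oplus V^{\otimes2}$. The following statements are equivalent. (a) For every Nijenhuis algebra $(N,P)$ over $\mathbf{k}$, the quadruple $(N,\prec_P,\succ_P,\bullet_P)$ is a $\mathcal{P}$-algebra, where $x\prec_P y=xP(y)$, $x\succ_P y=P(x)y$, $x\bullet_P y=-P(xy)$. (b) The relation space $R$ of $\mathcal{P}$ is contained in the subspace of $V^{\otimes2}\oplus V^{\otimes2}$ spanned by $$(\prec\otimes\prec,\ \prec\otimes\star),$$ $$(\succ\otimes\prec,\ \succ\otimes\prec),$$ $$(\star\otimes\succ,\ \succ\otimes\succ),$$ $$(\prec\otimes\bullet,\ \bullet\otimes\succ),$$ $$(\succ\otimes\bullet+\bullet\otimes\prec+\bullet\otimes\bullet,\ \ \succ\otimes\bullet+\bullet\otimes\prec+\bullet\otimes\bullet),$$ where $\star=\prec+\succ+\bullet$. More precisely, any $\mathcal{P}$-algebra $A$ satisfies the relations $$(x\prec y)\prec z=x\prec(y\prec z)+x\prec(y\succ z)+x\prec(y\bullet z),$$ $$(x\succ y)\prec z=x\succ(y\prec z),$$ $$(x\prec y)\succ z+(x\succ y)\succ z+(x\bullet y)\succ z=x\succ(y\succ z),$$ $$(x\prec y)\bullet z=x\bullet(y\succ z),$$ $$(x\succ y)\bullet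 z+(x\bullet y)\prec z+(x\bullet y)\bullet z=x\succ(y\bullet z)+x\bullet(y\prec z)+x\bullet(y\bullet z)$$ for all $x,y,z\in A$.
   Context: All algebras are over the field $\mathbf{k}$ and are nonunitary (not necessarily unital) associative. A Nijenhuis algebra is an algebra $N$ with a $\mathbf{k}$-linear endomorphism $P:N\to N$ satisfying $P(x)P(y)=P(P(x)y)+P(xP(y))-P^2(xy)$ for all $x,y\in N$. A binary quadratic nonsymmetric operad is determined by a pair $(V,R)$, where $V$ is a vector space (the space of generating binary operations) and $R$ is a subspace of $V^{\otimes2}\oplus V^{\otimes2}$ (the space of relations); it is written $\mathcal{P}(V)/(R)$. A $\mathcal{P}$-algebra for $\mathcal{P}=\mathcal{P}(V)/(R)$ is a $\mathbf{k}$-vector space $A$ with bilinear operations indexed (linearly) by $V$ such that for every element $$\Big(\sum_{i=1}^k\odot^{(1)}_i\otimes\odot^{(2)}_i,\ \sum_{j=1}^m\odot^{(3)}_j\otimes\odot^{(4)}_j\Big)\in R,\qquad \odot^{(1)}_i,\odot^{(2)}_i,\odot^{(3)}_j,\odot^{(4)}_j\in V,$$ one has $$\sum_{i=1}^k(x\odot^{(1)}_iy)\odot^{(2)}_iz=\sum_{j=1}^mx\odot^{(3)}_j(y\odot^{(4)}_jz)\quad\text{for all }x,y,z\in A.$$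
   Formalization: "Any P-algebra A satisfies the relations" fails for R = 0, so it is proved only when R contains the given span; containment of R in the span is instead shown equivalent to: every space with three bilinear operations satisfying the five relations is a P-algebra. *)

theory Defs
  imports "HOL-Algebra.Algebraic_Closure_Type" "HOL-Analysis.Cartesian_Space"
begin

unbundle no inner_syntax

text \<open>
  The ground field is the type \<open>'k::field\<close>; the HOL-Algebra record of its operations is
  \<^const>\<open>ring_of_type_algebra\<close>. Vector spaces and algebras over it live on explicit carriers, so
  that they can be quantified over inside a formula. A quantifier over all algebras on carriers in a
  type \<open>'n\<close> reaches every algebra of dimension at most \<open>\<aleph>\<^sub>0\<close>, up to isomorphism, as soon
  as \<open>'n\<close> is infinite and at least as large as \<open>'k\<close>. The record \<open>('k, 'n) module\<close> extends
  \<open>ring\<close>; of the inherited fields, \<open>one\<close> is never used below, and \<open>mult\<close> is used only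
  for associative (Nijenhuis) algebras.
\<close>


section \<open>Nijenhuis algebras\<close>

locale nonunital_algebra = Module.module "ring_of_type_algebra :: 'k ring" N
  for N :: "('k::field, 'n) module" (structure) +
  assumes mult_closed: "\<lbrakk>x \<in> carrier N; y \<in> carrier N\<rbrakk> \<Longrightarrow> x \<otimes> y \<in> carrier N"
    and mult_assoc: "\<lbrakk>x \<in> carrier N; y \<in> carrier N; z \<in> carrier N\<rbrakk>
      \<Longrightarrow> (x \<otimes> y) \<otimes> z = x \<otimes> (y \<otimes> z)"
    and mult_add_left: "\<lbrakk>x \<in> carrier N; y \<in> carrier N; z \<in> carrier N\<rbrakk>
      \<Longrightarrow> (x \<oplus> y) \<otimes> z = (x \<otimes> z) \<oplus> (y \<otimes> z)"
    and mult_add_right: "\<lbrakk>x \<in> carrier N; y \<in> carrier N; z \<in> carrier N\<rbrakk>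
      \<Longrightarrow> x \<otimes> (y \<oplus> z) = (x \<otimes> y) \<oplus> (x \<otimes> z)"
    and mult_smult_left: "\<lbrakk>x \<in> carrier N; y \<in> carrier N\<rbrakk>
      \<Longrightarrow> (c \<odot> x) \<otimes> y = c \<odot> (x \<otimes> y)"
    and mult_smult_right: "\<lbrakk>x \<in> carrier N; y \<in> carrier N\<rbrakk>
      \<Longrightarrow> x \<otimes> (c \<odot> y) = c \<odot> (x \<otimes> y)"

locale nijenhuis_algebra = nonunital_algebra N
  for N :: "('k::field, 'n) module" (structure) +
  fixes P :: "'n \<Rightarrow> 'n"
  assumes P_closed: "x \<in> carrier N \<Longrightarrow> P x \<in> carrier N"
    and P_add: "\<lbrakk>x \<in> carrier N; y \<in> carrier N\<rbrakk> \<Longrightarrow> P (x \<oplus> y) = P x \<oplus> P y"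
    and P_smult: "x \<in> carrier N \<Longrightarrow> P (c \<odot> x) = c \<odot> P x"
    and nijenhuis: "\<lbrakk>x \<in> carrier N; y \<in> carrier N\<rbrakk>
      \<Longrightarrow> P x \<otimes> P y = P (P x \<otimes> y) \<oplus> P (x \<otimes> P y) \<ominus> P (P (x \<otimes> y))"


section \<open>Binary quadratic nonsymmetric operads and their algebras\<close>

text \<open>
  The space \<open>V\<close> of generating operations with basis \<open>'g\<close> is \<open>'k ^ 'g\<close>, its tensor
  square is \<open>'k ^ ('g \<times> 'g)\<close> with the elementary tensors below, and the direct sum of two copies
  of the latter is their product. A presentation is a subspace of this product.
\<close>

type_synonym ('k, 'g) quadratic = "('k ^ ('g \<times> 'g)) \<times> ('k ^ ('g \<times> 'g))"

definition tensor :: "'k::field ^ 'g::finite \<Rightarrow> 'k ^ 'g \<Rightarrow> 'k ^ ('g \<times> 'g)" where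
  "tensor u v = (\<chi> p. u $ fst p * v $ snd p)"

definition quadratic_scale ::
    "'k::field \<Rightarrow> ('k, 'g::finite) quadratic \<Rightarrow> ('k, 'g) quadratic" where
  "quadratic_scale c r = (c *s fst r, c *s snd r)"

global_interpretation quadratic: vector_space
  "quadratic_scale :: 'k::field \<Rightarrow> ('k, 'g::finite) quadratic \<Rightarrow> _"
  by unfold_locales (simp_all add: quadratic_scale_def prod_eq_iff vec_eq_iff algebra_simps)

text \<open>A vector space with a bilinear operation for each element of the basis \<open>'g\<close> of \<open>V\<close>.\<close>

locale binary_algebra = Module.module "ring_of_type_algebra :: 'k ring" A
  for A :: "('k::field, 'n) module" (structure) +
  fixes m :: "'g::finite \<Rightarrow> 'n \<Rightarrow> 'n \<Rightarrow> 'n"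
  assumes op_closed: "\<lbrakk>x \<in> carrier A; y \<in> carrier A\<rbrakk> \<Longrightarrow> m g x y \<in> carrier A"
    and op_add_left: "\<lbrakk>x \<in> carrier A; y \<in> carrier A; z \<in> carrier A\<rbrakk>
      \<Longrightarrow> m g (x \<oplus> y) z = m g x z \<oplus> m g y z"
    and op_add_right: "\<lbrakk>x \<in> carrier A; y \<in> carrier A; z \<in> carrier A\<rbrakk>
      \<Longrightarrow> m g x (y \<oplus> z) = m g x y \<oplus> m g x z"
    and op_smult_left: "\<lbrakk>x \<in> carrier A; y \<in> carrier A\<rbrakk>
      \<Longrightarrow> m g (c \<odot> x) y = c \<odot> m g x y"
    and op_smult_right: "\<lbrakk>x \<in> carrier A; y \<in> carrier A\<rbrakk>
      \<Longrightarrow> m g x (c \<odot> y) = c \<odot> m g x y"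

text \<open>The operation indexed by an arbitrary \<open>v \<in> V\<close>, by linear extension from the basis.\<close>

definition operation :: "('k::field, 'n) module \<Rightarrow> ('g::finite \<Rightarrow> 'n \<Rightarrow> 'n \<Rightarrow> 'n)
    \<Rightarrow> 'k ^ 'g \<Rightarrow> 'n \<Rightarrow> 'n \<Rightarrow> 'n" where
  "operation A m v x y = (\<Oplus>\<^bsub>A\<^esub> g \<in> UNIV. (v $ g) \<odot>\<^bsub>A\<^esub> m g x y)"

definition operad_algebra :: "('k::field, 'g::finite) quadratic set
    \<Rightarrow> ('k, 'n) module \<Rightarrow> ('g \<Rightarrow> 'n \<Rightarrow> 'n \<Rightarrow> 'n) \<Rightarrow> bool" where
  "operad_algebra R A m \<longleftrightarrow> binary_algebra A m \<and>
    (\<forall>(k::nat) (l::nat) a b c d.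
      ((\<Sum>i<k. tensor (a i) (b i)), (\<Sum>j<l. tensor (c j) (d j))) \<in> R \<longrightarrow>
      (\<forall>x\<in>carrier A. \<forall>y\<in>carrier A. \<forall>z\<in>carrier A.
        (\<Oplus>\<^bsub>A\<^esub> i \<in> {..<k}. operation A m (b i) (operation A m (a i) x y) z) =
        (\<Oplus>\<^bsub>A\<^esub> j \<in> {..<l}. operation A m (c j) x (operation A m (d j) y z))))"


section \<open>The three operations and the distinguished relations\<close>

datatype gen = Prec | Succ | Bullet

instance gen :: finite
proof
  have "(UNIV :: gen set) = {Prec, Succ, Bullet}"
    using gen.exhaust by auto
  then show "finite (UNIV :: gen set)"
    by (metis finite.emptyI finite.insertI)
qed

definition nijenhuis_ops ::
    "('k::field, 'n) module \<Rightarrow> ('n \<Rightarrow> 'n) \<Rightarrow> gen \<Rightarrow> 'n \<Rightarrow> 'n \<Rightarrow> 'n" where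
  "nijenhuis_ops N P g x y = (case g of
      Prec \<Rightarrow> x \<otimes>\<^bsub>N\<^esub> P y
    | Succ \<Rightarrow> P x \<otimes>\<^bsub>N\<^esub> y
    | Bullet \<Rightarrow> \<ominus>\<^bsub>N\<^esub> P (x \<otimes>\<^bsub>N\<^esub> y))"

definition basis_tensor :: "gen \<Rightarrow> gen \<Rightarrow> 'k::field ^ (gen \<times> gen)" where
  "basis_tensor g h = tensor (axis g 1) (axis h 1)"

definition star :: "'k::field ^ gen" where
  "star = axis Prec 1 + axis Succ 1 + axis Bullet 1"

definition nijenhuis_relations :: "('k::field, gen) quadratic set" where
  "nijenhuis_relations = quadratic.span {
     (basis_tensor Prec Prec, tensor (axis Prec 1) star),
     (basis_tensor Succ Prec, basis_tensor Succ Prec),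
     (tensor star (axis Succ 1), basis_tensor Succ Succ),
     (basis_tensor Prec Bullet, basis_tensor Bullet Succ),
     (basis_tensor Succ Bullet + basis_tensor Bullet Prec + basis_tensor Bullet Bullet,
      basis_tensor Succ Bullet + basis_tensor Bullet Prec + basis_tensor Bullet Bullet)}"

locale nijenhuis_identities =
  fixes A :: "('k::field, 'n) module" (structure)
    and prec (infixl "\<prec>" 75)
    and succ (infixl "\<succ>" 75)
    and bullet (infixl "\<bullet>" 75)
  assumes identity1: "\<lbrakk>x \<in> carrier A; y \<in> carrier A; z \<in> carrier A\<rbrakk> \<Longrightarrow>
      (x \<prec> y) \<prec> z = x \<prec> (y \<prec> z) \<oplus> x \<prec> (y \<succ> z) \<oplus> x \<prec> (y \<bullet> z)"
    and identity2: "\<lbrakk>x \<in> carrier A; y \<in> carrier A; z \<in> carrier A\<rbrakk> \<Longrightarrow>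
      (x \<succ> y) \<prec> z = x \<succ> (y \<prec> z)"
    and identity3: "\<lbrakk>x \<in> carrier A; y \<in> carrier A; z \<in> carrier A\<rbrakk> \<Longrightarrow>
      (x \<prec> y) \<succ> z \<oplus> (x \<succ> y) \<succ> z \<oplus> (x \<bullet> y) \<succ> z = x \<succ> (y \<succ> z)"
    and identity4: "\<lbrakk>x \<in> carrier A; y \<in> carrier A; z \<in> carrier A\<rbrakk> \<Longrightarrow>
      (x \<prec> y) \<bullet> z = x \<bullet> (y \<succ> z)"
    and identity5: "\<lbrakk>x \<in> carrier A; y \<in> carrier A; z \<in> carrier A\<rbrakk> \<Longrightarrow>
      (x \<succ> y) \<bullet> z \<oplus> (x \<bullet> y) \<prec> z \<oplus> (x \<bullet> y) \<bullet> z =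
      x \<succ> (y \<bullet> z) \<oplus> x \<bullet> (y \<prec> z) \<oplus> x \<bullet> (y \<bullet> z)"

end

theory Submission
  imports Defs
begin

text \<open>
  A relation is a condition on a pair of tensors, and the relations which hold in a fixed algebra
  form a subspace; so if \<open>R\<close> is contained in the span of the five distinguished relations, it
  suffices to check these five in a Nijenhuis algebra.

  For the converse no free Nijenhuis algebra is needed. On the span of the words
  \<open>x, y, z, xy, yz, xyz\<close>, with products of other words set to zero, the diagonal operator with
  \<open>P x = a x\<close>, \<open>P y = b y\<close>, \<open>P z = c z\<close> is Nijenhuis as soon as the eigenvalue of each
  composite word is that of one of its factors, for every factorization. This leaves five families
  of eigenvalues at \<open>(xy, yz, xyz)\<close>, namely \<open>(a, b, a)\<close>, \<open>(a, c, a)\<close>, \<open>(a, c, c)\<close>,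
  \<open>(b, c, c)\<close> and \<open>(b, b, b)\<close>. In each of them, a relation in \<open>R\<close> evaluated at \<open>x, y, z\<close>
  becomes a quadratic form in \<open>a, b, c\<close> vanishing identically, hence (over any field) with zero
  coefficients. The resulting linear equations have rank 13 on the 18-dimensional space
  \<open>V\<^sup>\<otimes>\<^sup>2 \<oplus> V\<^sup>\<otimes>\<^sup>2\<close> and cut out the span of the five relations.
\<close>

section \<open>Vector spaces on explicit carriers\<close>

text \<open>Common base of \<open>nonunital_algebra\<close> and \<open>binary_algebra\<close>.
  Unfolding the ring record here lets later scalars be handled by the arithmetic of the type
  \<open>'k\<close>.\<close>

locale carrier_vector_space = Module.module "ring_of_type_algebra :: 'k ring" A
  for A :: "('k::field, 'n) module" (structure)
begin

lemma scale_closed: "x \<in> carrier A \<Longrightarrow> c \<odot> x \<in> carrier A"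
  using smult_closed by (simp add: ring_of_type_algebra_def)

lemma scale_add_left: "x \<in> carrier A \<Longrightarrow> (a + b) \<odot> x = a \<odot> x \<oplus> b \<odot> x"
  using smult_l_distr by (simp add: ring_of_type_algebra_def)

lemma scale_scale: "x \<in> carrier A \<Longrightarrow> a \<odot> (b \<odot> x) = (a * b) \<odot> x"
  using smult_assoc1 by (simp add: ring_of_type_algebra_def)

lemma scale_one: "x \<in> carrier A \<Longrightarrow> 1 \<odot> x = x"
  using smult_one by (simp add: ring_of_type_algebra_def)

lemma scale_zero_left: "x \<in> carrier A \<Longrightarrow> 0 \<odot> x = \<zero>"
  using smult_l_null by (simp add: ring_of_type_algebra_def)

lemma scale_minus_right: "x \<in> carrier A \<Longrightarrow> c \<odot> (\<ominus> x) = \<ominus> (c \<odot> x)"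
  using smult_r_minus by (simp add: ring_of_type_algebra_def)

lemma scale_finsum:
  "\<lbrakk>finite I; f \<in> I \<rightarrow> carrier A\<rbrakk> \<Longrightarrow> c \<odot> (\<Oplus>i\<in>I. f i) = (\<Oplus>i\<in>I. c \<odot> f i)"
  using finsum_smult_ldistr by (simp add: ring_of_type_algebra_def)

lemma additive_zero:
  assumes "\<And>x. x \<in> carrier A \<Longrightarrow> f x \<in> carrier A"
    and "\<And>x y. \<lbrakk>x \<in> carrier A; y \<in> carrier A\<rbrakk> \<Longrightarrow> f (x \<oplus> y) = f x \<oplus> f y"
  shows "f \<zero> = \<zero>"
  using assms(1)[of \<zero>] assms(2)[of \<zero> \<zero>] by (metis M.add.r_cancel_one' M.r_zero M.zero_closed)

lemma additive_minus:
  assumes f: "\<And>x. x \<in> carrier A \<Longrightarrow> f x \<in> carrier A"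
    and add: "\<And>x y. \<lbrakk>x \<in> carrier A; y \<in> carrier A\<rbrakk> \<Longrightarrow> f (x \<oplus> y) = f x \<oplus> f y"
    and x: "x \<in> carrier A"
  shows "f (\<ominus> x) = \<ominus> f x"
proof -
  have "f (\<ominus> x) \<oplus> f x = f (\<ominus> x \<oplus> x)" using x by (simp add: add)
  also have "\<dots> = \<zero>" using x additive_zero[of f] f add by (simp add: M.l_neg)
  finally show ?thesis using f x by (metis M.a_inv_closed M.minus_equality)
qed

lemma additive_finsum:
  assumes "finite I" "F \<in> I \<rightarrow> carrier A"
    and f: "\<And>x. x \<in> carrier A \<Longrightarrow> f x \<in> carrier A"
    and add: "\<And>x y. \<lbrakk>x \<in> carrier A; y \<in> carrier A\<rbrakk> \<Longrightarrow> f (x \<oplus> y) = f x \<oplus> f y"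
  shows "f (\<Oplus>i\<in>I. F i) = (\<Oplus>i\<in>I. f (F i))"
  using assms(1,2)
proof (induction rule: finite_induct)
  case empty
  then show ?case using additive_zero[of f] f add by simp
next
  case (insert i I)
  then have "F i \<in> carrier A" "F \<in> I \<rightarrow> carrier A" by auto
  then show ?case using insert f
    by (simp add: add Pi_iff)
qed

text \<open>Meant for the coefficient functional at \<open>xyz\<close>, whose values lie in the type
  \<open>'k\<close> and not in the carrier.\<close>

lemma additive_functional_finsum:
  fixes f :: "'n \<Rightarrow> 'k"
  assumes "finite I" "F \<in> I \<rightarrow> carrier A"
    and add: "\<And>x y. \<lbrakk>x \<in> carrier A; y \<in> carrier A\<rbrakk> \<Longrightarrow> f (x \<oplus> y) = f x + f y"
  shows "f (\<Oplus>i\<in>I. F i) = (\<Sum>i\<in>I. f (F i))"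
  using assms(1,2)
proof (induction rule: finite_induct)
  case empty
  have "f \<zero> + f \<zero> = f \<zero> + 0" using add[of \<zero> \<zero>] by simp
  then show ?case unfolding add_left_cancel by simp
next
  case (insert i I)
  then have "F i \<in> carrier A" "F \<in> I \<rightarrow> carrier A" by auto
  then show ?case using insert
    by (simp add: add Pi_iff)
qed

end

sublocale nonunital_algebra \<subseteq> carrier_vector_space N ..

sublocale binary_algebra \<subseteq> carrier_vector_space A ..

section \<open>Evaluating quadratic relations\<close>

text \<open>A tensor is evaluated through its coordinates, so that no decomposition into elementary
  tensors has to be chosen. The outer operation is summed outermost (\<open>h\<close> here,
  \<open>g\<close> in \<open>right_value\<close>), matching the nesting of
  \<open>operation\<close>.\<close>

definition left_value :: "('k::field, 'n) module \<Rightarrow> ('g::finite \<Rightarrow> 'n \<Rightarrow> 'n \<Rightarrow> 'n)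
    \<Rightarrow> 'k ^ ('g \<times> 'g) \<Rightarrow> 'n \<Rightarrow> 'n \<Rightarrow> 'n \<Rightarrow> 'n" where
  "left_value A m t x y z =
    (\<Oplus>\<^bsub>A\<^esub>h\<in>UNIV. \<Oplus>\<^bsub>A\<^esub>g\<in>UNIV. (t $ (g, h)) \<odot>\<^bsub>A\<^esub> m h (m g x y) z)"

definition right_value :: "('k::field, 'n) module \<Rightarrow> ('g::finite \<Rightarrow> 'n \<Rightarrow> 'n \<Rightarrow> 'n)
    \<Rightarrow> 'k ^ ('g \<times> 'g) \<Rightarrow> 'n \<Rightarrow> 'n \<Rightarrow> 'n \<Rightarrow> 'n" where
  "right_value A m t x y z =
    (\<Oplus>\<^bsub>A\<^esub>g\<in>UNIV. \<Oplus>\<^bsub>A\<^esub>h\<in>UNIV. (t $ (g, h)) \<odot>\<^bsub>A\<^esub> m g x (m h y z))"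

definition satisfies :: "('k::field, 'n) module \<Rightarrow> ('g::finite \<Rightarrow> 'n \<Rightarrow> 'n \<Rightarrow> 'n)
    \<Rightarrow> ('k, 'g) quadratic \<Rightarrow> bool" where
  "satisfies A m r \<longleftrightarrow> (\<forall>x\<in>carrier A. \<forall>y\<in>carrier A. \<forall>z\<in>carrier A.
    left_value A m (fst r) x y z = right_value A m (snd r) x y z)"

text \<open>Each coordinate contributes one elementary tensor, its scalar placed in the left factor.
  The pairs are renumbered by an initial segment of the naturals, the kind of index set that
  \<open>operad_algebra\<close> uses.\<close>

lemma sum_of_tensors:
  fixes t :: "'k::field ^ ('g::finite \<times> 'g)"
  obtains n :: nat and a b where "t = (\<Sum>i<n. tensor (a i) (b i))"
proof -
  obtain e :: "nat \<Rightarrow> 'g \<times> 'g" where e: "bij_betw e {..<CARD('g \<times> 'g)} UNIV"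
    using ex_bij_betw_nat_finite[of "UNIV :: ('g \<times> 'g) set"] unfolding atLeast0LessThan
    by (auto simp del: card_prod)
  have "t = (\<Sum>p\<in>UNIV. tensor (axis (fst p) (t $ p)) (axis (snd p) 1))"
  proof (subst vec_eq_iff, rule allI)
    fix q :: "'g \<times> 'g"
    have "(\<Sum>p\<in>UNIV. tensor (axis (fst p) (t $ p)) (axis (snd p) 1)) $ q
        = (\<Sum>p\<in>UNIV. if p = q then t $ p else 0)"
      unfolding sum_component
      by (rule sum.cong) (auto simp: tensor_def axis_def prod_eq_iff)
    then show "t $ q = (\<Sum>p\<in>UNIV. tensor (axis (fst p) (t $ p)) (axis (snd p) 1)) $ q"
      by simp
  qed
  also have "\<dots> = (\<Sum>i<CARD('g \<times> 'g).
      tensor (axis (fst (e i)) (t $ e i)) (axis (snd (e i)) 1))"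
    by (rule sum.reindex_bij_betw[OF e, symmetric])
  finally show ?thesis by (rule that)
qed

context binary_algebra
begin

lemma operation_closed [simp]:
  "\<lbrakk>x \<in> carrier A; y \<in> carrier A\<rbrakk> \<Longrightarrow> operation A m v x y \<in> carrier A"
  unfolding operation_def by (intro finsum_closed funcsetI scale_closed op_closed)

lemma left_term_closed:
  "\<lbrakk>x \<in> carrier A; y \<in> carrier A; z \<in> carrier A\<rbrakk> \<Longrightarrow> c \<odot> m h (m g x y) z \<in> carrier A"
  by (intro scale_closed op_closed)

lemma right_term_closed:
  "\<lbrakk>x \<in> carrier A; y \<in> carrier A; z \<in> carrier A\<rbrakk> \<Longrightarrow> c \<odot> m g x (m h y z) \<in> carrier A"
  by (intro scale_closed op_closed)

lemma left_value_closed [simp]: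
  "\<lbrakk>x \<in> carrier A; y \<in> carrier A; z \<in> carrier A\<rbrakk> \<Longrightarrow> left_value A m t x y z \<in> carrier A"
  unfolding left_value_def by (intro finsum_closed funcsetI left_term_closed)

lemma right_value_closed [simp]:
  "\<lbrakk>x \<in> carrier A; y \<in> carrier A; z \<in> carrier A\<rbrakk> \<Longrightarrow> right_value A m t x y z \<in> carrier A"
  unfolding right_value_def by (intro finsum_closed funcsetI right_term_closed)

lemma op_finsum_left:
  "\<lbrakk>finite I; F \<in> I \<rightarrow> carrier A; y \<in> carrier A\<rbrakk>
    \<Longrightarrow> m g (\<Oplus>i\<in>I. F i) y = (\<Oplus>i\<in>I. m g (F i) y)"
  by (rule additive_finsum) (auto intro: op_closed op_add_left)

lemma op_finsum_right:
  "\<lbrakk>finite I; F \<in> I \<rightarrow> carrier A; x \<in> carrier A\<rbrakk>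
    \<Longrightarrow> m g x (\<Oplus>i\<in>I. F i) = (\<Oplus>i\<in>I. m g x (F i))"
  by (rule additive_finsum) (auto intro: op_closed op_add_right)

text \<open>Bilinearity pulls the inner sum out of the outer operation; the double sums then agree
  term by term.\<close>

lemma left_value_tensor:
  assumes "x \<in> carrier A" "y \<in> carrier A" "z \<in> carrier A"
  shows "left_value A m (tensor a b) x y z = operation A m b (operation A m a x y) z"
  unfolding left_value_def operation_def using assms
  by (intro M.add.finprod_cong' refl)
    (simp_all add: op_finsum_left scale_finsum op_smult_left scale_scale op_closed scale_closed
      tensor_def mult.commute)

lemma right_value_tensor:
  assumes "x \<in> carrier A" "y \<in> carrier A" "z \<in> carrier A"
  shows "right_value A m (tensor a b) x y z = operation A m a x (operation A m b y z)"
  unfolding right_value_def operation_def using assms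
  by (intro M.add.finprod_cong' refl)
    (simp_all add: op_finsum_right scale_finsum op_smult_right scale_scale op_closed scale_closed
      tensor_def)

lemma left_value_add:
  assumes "x \<in> carrier A" "y \<in> carrier A" "z \<in> carrier A"
  shows "left_value A m (s + t) x y z = left_value A m s x y z \<oplus> left_value A m t x y z"
  unfolding left_value_def using assms
  by (simp add: scale_add_left finsum_addf left_term_closed op_closed)

lemma right_value_add:
  assumes "x \<in> carrier A" "y \<in> carrier A" "z \<in> carrier A"
  shows "right_value A m (s + t) x y z = right_value A m s x y z \<oplus> right_value A m t x y z"
  unfolding right_value_def using assms
  by (simp add: scale_add_left finsum_addf right_term_closed op_closed)

lemma left_value_scale:
  assumes "x \<in> carrier A" "y \<in> carrier A" "z \<in> carrier A"
  shows "left_value A m (c *s t) x y z = c \<odot> left_value A m t x y z"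
  unfolding left_value_def using assms
  by (simp add: scale_finsum scale_scale left_term_closed op_closed)

lemma right_value_scale:
  assumes "x \<in> carrier A" "y \<in> carrier A" "z \<in> carrier A"
  shows "right_value A m (c *s t) x y z = c \<odot> right_value A m t x y z"
  unfolding right_value_def using assms
  by (simp add: scale_finsum scale_scale right_term_closed op_closed)

lemma left_value_zero:
  "\<lbrakk>x \<in> carrier A; y \<in> carrier A; z \<in> carrier A\<rbrakk> \<Longrightarrow> left_value A m 0 x y z = \<zero>"
  by (simp add: left_value_def scale_zero_left op_closed)

lemma right_value_zero:
  "\<lbrakk>x \<in> carrier A; y \<in> carrier A; z \<in> carrier A\<rbrakk> \<Longrightarrow> right_value A m 0 x y z = \<zero>"
  by (simp add: right_value_def scale_zero_left op_closed)

lemma left_value_sum: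
  assumes "finite I" "x \<in> carrier A" "y \<in> carrier A" "z \<in> carrier A"
  shows "left_value A m (\<Sum>i\<in>I. t i) x y z = (\<Oplus>i\<in>I. left_value A m (t i) x y z)"
  using assms by (induction rule: finite_induct) (simp_all add: left_value_zero left_value_add)

lemma right_value_sum:
  assumes "finite I" "x \<in> carrier A" "y \<in> carrier A" "z \<in> carrier A"
  shows "right_value A m (\<Sum>i\<in>I. t i) x y z = (\<Oplus>i\<in>I. right_value A m (t i) x y z)"
  using assms by (induction rule: finite_induct) (simp_all add: right_value_zero right_value_add)

lemma operation_add:
  assumes "x \<in> carrier A" "y \<in> carrier A"
  shows "operation A m (u + v) x y = operation A m u x y \<oplus> operation A m v x y"
  unfolding operation_def using assms
  by (simp add: scale_add_left finsum_addf scale_closed op_closed)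

lemma operation_axis:
  assumes "x \<in> carrier A" "y \<in> carrier A"
  shows "operation A m (axis g 1) x y = m g x y"
proof -
  have "operation A m (axis g 1) x y = (\<Oplus>h\<in>UNIV. if g = h then m h x y else \<zero>)"
    unfolding operation_def using assms
    by (intro M.add.finprod_cong' refl)
      (auto simp: axis_def scale_one scale_zero_left op_closed)
  then show ?thesis using assms
    by (simp add: M.add.finprod_singleton op_closed)
qed

lemma subspace_satisfies: "quadratic.subspace {r. satisfies A m r}"
  unfolding quadratic.subspace_def satisfies_def
  by (auto simp: quadratic_scale_def left_value_zero right_value_zero left_value_add
      right_value_add left_value_scale right_value_scale)

lemma satisfies_span:
  "(\<forall>r\<in>quadratic.span B. satisfies A m r) \<longleftrightarrow> (\<forall>r\<in>B. satisfies A m r)"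
  using quadratic.span_minimal[OF _ subspace_satisfies, of B] quadratic.span_superset[of B]
  by blast

text \<open>Both values are additive in the tensor and reduce to nested \<open>operation\<close> on
  elementary tensors, so all decompositions of a relation impose the same condition;
  \<open>sum_of_tensors\<close> supplies one.\<close>

lemma operad_algebra_iff: "operad_algebra R A m \<longleftrightarrow> (\<forall>r\<in>R. satisfies A m r)"
proof
  assume R: "operad_algebra R A m"
  show "\<forall>r\<in>R. satisfies A m r"
  proof
    fix r assume r: "r \<in> R"
    obtain k :: nat and a b where 1: "fst r = (\<Sum>i<k. tensor (a i) (b i))" by (rule sum_of_tensors)
    obtain l :: nat and c d where 2: "snd r = (\<Sum>i<l. tensor (c i) (d i))" by (rule sum_of_tensors)
    have "((\<Sum>i<k. tensor (a i) (b i)), (\<Sum>i<l. tensor (c i) (d i))) \<in> R"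
      using r 1 2 by (metis prod.collapse)
    with R show "satisfies A m r"
      unfolding operad_algebra_def satisfies_def 1 2
      by (simp add: left_value_sum right_value_sum left_value_tensor right_value_tensor)
  qed
next
  assume "\<forall>r\<in>R. satisfies A m r"
  then show "operad_algebra R A m"
    unfolding operad_algebra_def satisfies_def using binary_algebra_axioms
    by (fastforce simp: left_value_sum right_value_sum left_value_tensor right_value_tensor)
qed

end

section \<open>The five relations as identities, and their validity in Nijenhuis algebras\<close>

lemma operation_star:
  assumes "binary_algebra A m" "x \<in> carrier A" "y \<in> carrier A"
  shows "operation A m star x y = m Prec x y \<oplus>\<^bsub>A\<^esub> m Succ x y \<oplus>\<^bsub>A\<^esub> m Bullet x y"
  using assms
  by (simp add: star_def binary_algebra.operation_add binary_algebra.operation_axis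
      binary_algebra.operation_closed)

lemma satisfies_nijenhuis_relations_iff:
  assumes "binary_algebra A m"
  shows "(\<forall>r\<in>nijenhuis_relations. satisfies A m r)
    \<longleftrightarrow> nijenhuis_identities A (m Prec) (m Succ) (m Bullet)"
proof -
  interpret binary_algebra A m by fact
  show ?thesis
    unfolding nijenhuis_relations_def satisfies_span
    by (auto simp: satisfies_def basis_tensor_def left_value_add right_value_add
        left_value_tensor right_value_tensor operation_axis operation_star[OF assms]
        op_closed op_add_left op_add_right nijenhuis_identities_def)
qed

lemma nijenhuis_binary_algebra:
  assumes "nijenhuis_algebra N P"
  shows "binary_algebra N (nijenhuis_ops N P)"
proof -
  interpret nijenhuis_algebra N P by fact
  show ?thesis
    by unfold_locales
      (auto simp: nijenhuis_ops_def mult_closed P_closed P_add P_smult mult_add_left mult_add_right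
        mult_smult_left mult_smult_right M.minus_add scale_minus_right scale_closed split: gen.split)
qed

context nijenhuis_algebra
begin

lemma P_minus: "x \<in> carrier N \<Longrightarrow> P (\<ominus> x) = \<ominus> P x"
  by (rule additive_minus) (simp_all add: P_closed P_add)

lemma mult_minus_left: "\<lbrakk>x \<in> carrier N; y \<in> carrier N\<rbrakk> \<Longrightarrow> (\<ominus> x) \<otimes> y = \<ominus> (x \<otimes> y)"
  by (rule additive_minus[where f = "\<lambda>x. x \<otimes> y"]) (simp_all add: mult_closed mult_add_left)

lemma mult_minus_right: "\<lbrakk>x \<in> carrier N; y \<in> carrier N\<rbrakk> \<Longrightarrow> x \<otimes> (\<ominus> y) = \<ominus> (x \<otimes> y)"
  by (rule additive_minus[where f = "\<lambda>y. x \<otimes> y"]) (simp_all add: mult_closed mult_add_right)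

text \<open>The second and fourth identities are associativity alone. The first and third also
  expand \<open>P y \<otimes> P z\<close> and \<open>P x \<otimes> P y\<close> by the Nijenhuis
  identity; the fifth needs it on both sides.\<close>

lemma satisfies_nijenhuis_identities:
  "nijenhuis_identities N (nijenhuis_ops N P Prec) (nijenhuis_ops N P Succ)
    (nijenhuis_ops N P Bullet)"
proof unfold_locales
  fix x y z assume xyz: "x \<in> carrier N" "y \<in> carrier N" "z \<in> carrier N"
  note closed = xyz mult_closed P_closed
  note simps = closed P_minus mult_minus_left mult_minus_right M.minus_minus
  let ?prec = "nijenhuis_ops N P Prec"
  let ?succ = "nijenhuis_ops N P Succ"
  let ?bullet = "nijenhuis_ops N P Bullet"
  show "?prec (?prec x y) z = ?prec x (?prec y z) \<oplus> ?prec x (?succ y z) \<oplus> ?prec x (?bullet y z)"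
    by (simp add: nijenhuis_ops_def simps mult_assoc nijenhuis mult_add_right a_minus_def M.a_ac)
  show "?prec (?succ x y) z = ?succ x (?prec y z)"
    by (simp add: nijenhuis_ops_def simps mult_assoc)
  show "?succ (?prec x y) z \<oplus> ?succ (?succ x y) z \<oplus> ?succ (?bullet x y) z = ?succ x (?succ y z)"
    by (simp add: nijenhuis_ops_def simps mult_assoc[symmetric] nijenhuis mult_add_left
        a_minus_def M.a_ac)
  show "?bullet (?prec x y) z = ?bullet x (?succ y z)"
    by (simp add: nijenhuis_ops_def simps mult_assoc)
  \<comment> \<open>For the fifth identity: expanding \<open>P (x \<otimes> y) \<otimes> P z\<close>
    on the left produces \<open>b\<close>, and \<open>P x \<otimes> P (y \<otimes> z)\<close> on the
    right produces \<open>e\<close>; the last term of each side cancels it. Both sides become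
    \<open>\<ominus> a \<oplus> \<ominus> c \<oplus> d\<close>.\<close>
  have cancel: "\<ominus> a \<oplus> (\<ominus> (b \<oplus> c \<oplus> \<ominus> d)) \<oplus> b = (\<ominus> (a \<oplus> e \<oplus> \<ominus> d)) \<oplus> \<ominus> c \<oplus> e"
    if "a \<in> carrier N" "b \<in> carrier N" "c \<in> carrier N" "d \<in> carrier N" "e \<in> carrier N"
    for a b c d e
  proof -
    have "\<ominus> a \<oplus> (\<ominus> (b \<oplus> c \<oplus> \<ominus> d)) \<oplus> b = \<ominus> a \<oplus> \<ominus> c \<oplus> d \<oplus> (\<ominus> b \<oplus> b)"
      using that by (simp only: M.minus_add M.minus_minus M.a_ac M.a_inv_closed M.a_closed)
    moreover have "(\<ominus> (a \<oplus> e \<oplus> \<ominus> d)) \<oplus> \<ominus> c \<oplus> e = \<ominus> a \<oplus> \<ominus> c \<oplus> d \<oplus> (\<ominus> e \<oplus> e)"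
      using that by (simp only: M.minus_add M.minus_minus M.a_ac M.a_inv_closed M.a_closed)
    ultimately show ?thesis using that by (simp add: M.l_neg)
  qed
  show "?bullet (?succ x y) z \<oplus> ?prec (?bullet x y) z \<oplus> ?bullet (?bullet x y) z =
      ?succ x (?bullet y z) \<oplus> ?bullet x (?prec y z) \<oplus> ?bullet x (?bullet y z)"
    using cancel[of "P (P x \<otimes> (y \<otimes> z))" "P (P (x \<otimes> y) \<otimes> z)" "P (x \<otimes> (y \<otimes> P z))"
        "P (P (x \<otimes> (y \<otimes> z)))" "P (x \<otimes> P (y \<otimes> z))"]
    by (simp add: nijenhuis_ops_def simps mult_assoc nijenhuis a_minus_def)
qed

end

lemma nijenhuis_operad_algebra:
  assumes "nijenhuis_algebra N P" "R \<subseteq> nijenhuis_relations"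
  shows "operad_algebra R N (nijenhuis_ops N P)"
  using assms nijenhuis_binary_algebra[OF assms(1)]
    nijenhuis_algebra.satisfies_nijenhuis_identities[OF assms(1)]
  by (auto simp: binary_algebra.operad_algebra_iff satisfies_nijenhuis_relations_iff[symmetric])

section \<open>Six-dimensional Nijenhuis algebras with diagonal operator\<close>

text \<open>Transport of structure along an injection: the models are built on a product type,
  whereas the theorem speaks of carriers in \<open>'n\<close>.\<close>

definition image_algebra :: "('a::ab_group_add \<Rightarrow> 'n) \<Rightarrow> ('k \<Rightarrow> 'a \<Rightarrow> 'a) \<Rightarrow> ('a \<Rightarrow> 'a \<Rightarrow> 'a)
    \<Rightarrow> ('k, 'n) module" where
  "image_algebra \<phi> s \<mu> =
    \<lparr>carrier = range \<phi>, monoid.mult = (\<lambda>u v. \<phi> (\<mu> (the_inv \<phi> u) (the_inv \<phi> v))),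
     one = \<phi> 0, ring.zero = \<phi> 0, add = (\<lambda>u v. \<phi> (the_inv \<phi> u + the_inv \<phi> v)),
     Module.module.smult = (\<lambda>c u. \<phi> (s c (the_inv \<phi> u)))\<rparr>"

lemma module_image_algebra:
  fixes \<phi> :: "'a::ab_group_add \<Rightarrow> 'n" and s :: "'k::field \<Rightarrow> 'a \<Rightarrow> 'a"
  assumes "inj \<phi>" "vector_space s"
  shows "Module.module (ring_of_type_algebra :: 'k ring) (image_algebra \<phi> s \<mu>)"
proof (rule moduleI)
  interpret s: vector_space s by fact
  show "cring (ring_of_type_algebra :: 'k ring)" by (rule cring_from_type_algebra)
  show "abelian_group (image_algebra \<phi> s \<mu>)"
  proof (rule abelian_groupI)
    fix x assume "x \<in> carrier (image_algebra \<phi> s \<mu>)"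
    then obtain a where "x = \<phi> a" by (auto simp: image_algebra_def the_inv_f_f)
    then show "\<exists>y\<in>carrier (image_algebra \<phi> s \<mu>).
        y \<oplus>\<^bsub>image_algebra \<phi> s \<mu>\<^esub> x = \<zero>\<^bsub>image_algebra \<phi> s \<mu>\<^esub>"
      using assms(1) by (intro bexI[of _ "\<phi> (- a)"]) (auto simp: image_algebra_def the_inv_f_f)
  qed (use assms(1) in \<open>auto simp: image_algebra_def the_inv_f_f algebra_simps\<close>)
qed (use assms(1) in \<open>auto simp: image_algebra_def the_inv_f_f ring_of_type_algebra_def
    vector_space.vector_space_assms[OF assms(2)]\<close>)

lemma image_algebra_minus:
  fixes \<phi> :: "'a::ab_group_add \<Rightarrow> 'n" and s :: "'k::field \<Rightarrow> 'a \<Rightarrow> 'a"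
  assumes "inj \<phi>" "vector_space s"
  shows "\<ominus>\<^bsub>image_algebra \<phi> s \<mu>\<^esub> \<phi> a = \<phi> (- a)"
proof -
  interpret Module.module "ring_of_type_algebra :: 'k ring" "image_algebra \<phi> s \<mu>"
    by (rule module_image_algebra[OF assms])
  show ?thesis
    by (rule M.minus_equality) (use assms(1) in \<open>auto simp: image_algebra_def the_inv_f_f\<close>)
qed

lemma nijenhuis_image_algebra:
  fixes \<phi> :: "'a::ab_group_add \<Rightarrow> 'n" and s :: "'k::field \<Rightarrow> 'a \<Rightarrow> 'a"
  assumes inj: "inj \<phi>" and s: "vector_space s"
    and \<mu>: "\<And>a b c. \<mu> (\<mu> a b) c = \<mu> a (\<mu> b c)"
      "\<And>a b c. \<mu> (a + b) c = \<mu> a c + \<mu> b c" "\<And>a b c. \<mu> a (b + c) = \<mu> a b + \<mu> a c"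
      "\<And>k a b. \<mu> (s k a) b = s k (\<mu> a b)" "\<And>k a b. \<mu> a (s k b) = s k (\<mu> a b)"
    and Q: "\<And>a b. Q (a + b) = Q a + Q b" "\<And>k a. Q (s k a) = s k (Q a)"
      "\<And>a b. \<mu> (Q a) (Q b) = Q (\<mu> (Q a) b) + Q (\<mu> a (Q b)) - Q (Q (\<mu> a b))"
  shows "nijenhuis_algebra (image_algebra \<phi> s \<mu>) (\<lambda>u. \<phi> (Q (the_inv \<phi> u)))"
proof -
  interpret Module.module "ring_of_type_algebra :: 'k ring" "image_algebra \<phi> s \<mu>"
    by (rule module_image_algebra[OF inj s])
  note minus = image_algebra_minus[OF inj s, of \<mu>]
  have sub: "\<phi> a \<ominus>\<^bsub>image_algebra \<phi> s \<mu>\<^esub> \<phi> b = \<phi> (a - b)" for a b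
    unfolding a_minus_def minus using inj by (simp add: image_algebra_def the_inv_f_f)
  have simps: "carrier (image_algebra \<phi> s \<mu>) = range \<phi>"
    "\<phi> a \<otimes>\<^bsub>image_algebra \<phi> s \<mu>\<^esub> \<phi> b = \<phi> (\<mu> a b)"
    "\<phi> a \<oplus>\<^bsub>image_algebra \<phi> s \<mu>\<^esub> \<phi> b = \<phi> (a + b)"
    "c \<odot>\<^bsub>image_algebra \<phi> s \<mu>\<^esub> \<phi> b = \<phi> (s c b)" for a b c
    using inj by (simp_all add: image_algebra_def the_inv_f_f)
  show ?thesis
    by unfold_locales (use inj in \<open>auto simp: simps sub the_inv_f_f \<mu> Q(1,2)\<close>, simp_all add: Q(3)[symmetric])
qed

text \<open>The six coordinates belong to the words \<open>x\<close>, \<open>y\<close>, \<open>z\<close>, \<open>xy\<close>, \<open>yz\<close>, \<open>xyz\<close>; all other words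
  are set to zero.\<close>

type_synonym 'a words = "'a \<times> 'a \<times> 'a \<times> 'a \<times> 'a \<times> 'a"

fun words_mult :: "'a::semiring_0 words \<Rightarrow> 'a words \<Rightarrow> 'a words" where
  "words_mult (a1, a2, a3, a12, a23, a123) (b1, b2, b3, b12, b23, b123) =
    (0, 0, 0, a1 * b2, a2 * b3, a1 * b23 + a12 * b3)"

fun words_diag :: "'a::semiring_0 words \<Rightarrow> 'a words \<Rightarrow> 'a words" where
  "words_diag (t1, t2, t3, t12, t23, t123) (a1, a2, a3, a12, a23, a123) =
    (t1 * a1, t2 * a2, t3 * a3, t12 * a12, t23 * a23, t123 * a123)"

definition words_scale :: "'a::semiring_0 \<Rightarrow> 'a words \<Rightarrow> 'a words" where
  "words_scale c = words_diag (c, c, c, c, c, c)"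

text \<open>The coefficient at \<open>xyz\<close>, the only word that can occur in a product of
  three elements.\<close>

definition words_top :: "'a words \<Rightarrow> 'a" where
  "words_top = (\<lambda>(a1, a2, a3, a12, a23, a123). a123)"

text \<open>A diagonal operator with eigenvalue \<open>t\<^sub>w\<close> at the word \<open>w\<close> is Nijenhuis if
  \<open>(t\<^sub>u - t\<^sub>u\<^sub>v) (t\<^sub>v - t\<^sub>u\<^sub>v) = 0\<close> for every factorization \<open>w = uv\<close>.\<close>

fun nijenhuis_weights :: "'a::idom words \<Rightarrow> bool" where
  "nijenhuis_weights (t1, t2, t3, t12, t23, t123) \<longleftrightarrow>
    t12 \<in> {t1, t2} \<and> t23 \<in> {t2, t3} \<and> t123 \<in> {t12, t3} \<and> t123 \<in> {t1, t23}"

lemma vector_space_words: "vector_space (words_scale :: 'k::field \<Rightarrow> _)"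
  by unfold_locales (auto simp: words_scale_def algebra_simps)

text \<open>An infinite type is in bijection with its square, so five nested pairings encode six
  coordinates.\<close>

lemma inj_words:
  assumes "infinite (UNIV :: 'n set)" "\<exists>f :: 'k \<Rightarrow> 'n. inj f"
  shows "\<exists>\<phi> :: 'k words \<Rightarrow> 'n. inj \<phi>"
proof -
  obtain f :: "'k \<Rightarrow> 'n" where f: "inj f" using assms(2) by blast
  obtain e :: "'n \<times> 'n \<Rightarrow> 'n" where "bij_betw e (UNIV \<times> UNIV) UNIV"
    using card_of_Times_same_infinite[OF assms(1)] card_of_ordIso by blast
  then have e: "inj e" by (simp add: bij_betw_def)
  define \<phi> where "\<phi> = (\<lambda>(a1, a2, a3, a4, a5, a6).
    e (f a1, e (f a2, e (f a3, e (f a4, e (f a5, f a6))))))"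
  have "inj \<phi>"
    unfolding \<phi>_def by (rule injI) (auto dest!: injD[OF e] injD[OF f])
  then show ?thesis by blast
qed

lemma nijenhuis_words:
  fixes \<phi> :: "'k::field words \<Rightarrow> 'n"
  assumes "inj \<phi>" "nijenhuis_weights t"
  shows "nijenhuis_algebra (image_algebra \<phi> words_scale words_mult)
    (\<lambda>u. \<phi> (words_diag t (the_inv \<phi> u)))"
proof -
  obtain t1 t2 t3 t12 t23 t123 where t: "t = (t1, t2, t3, t12, t23, t123)"
    by (metis prod.exhaust)
  show ?thesis
    using assms(2)
    by (intro nijenhuis_image_algebra assms(1) vector_space_words)
      (auto simp: t words_scale_def algebra_simps)
qed

text \<open>The factor that an operation puts in front of the product of two words, where
  \<open>t\<close>, \<open>u\<close>, \<open>v\<close> are the eigenvalues of the left word, the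
  right word and their product.\<close>

definition weight_ops :: "'a::comm_ring_1 \<Rightarrow> 'a \<Rightarrow> 'a \<Rightarrow> gen \<Rightarrow> 'a" where
  "weight_ops t u v g = (case g of Prec \<Rightarrow> u | Succ \<Rightarrow> t | Bullet \<Rightarrow> - v)"

text \<open>Words are eigenvectors, so evaluation at \<open>x\<close>, \<open>y\<close>,
  \<open>z\<close> leaves a multiple of \<open>xyz\<close> on both sides. Each coefficient is a
  product of two weights: one for the inner product \<open>xy\<close> or \<open>yz\<close>, one for
  the outer product \<open>xyz\<close>.\<close>

lemma satisfies_words:
  fixes \<phi> :: "'k::field words \<Rightarrow> 'n" and r :: "('k, gen) quadratic"
  assumes inj: "inj \<phi>" and t: "nijenhuis_weights (t1, t2, t3, t12, t23, t123)"
    and sat: "satisfies (image_algebra \<phi> words_scale words_mult)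
      (nijenhuis_ops (image_algebra \<phi> words_scale words_mult)
        (\<lambda>u. \<phi> (words_diag (t1, t2, t3, t12, t23, t123) (the_inv \<phi> u)))) r"
  shows "(\<Sum>h\<in>UNIV. \<Sum>g\<in>UNIV. fst r $ (g, h) * (weight_ops t12 t3 t123 h * weight_ops t1 t2 t12 g)) =
    (\<Sum>g\<in>UNIV. \<Sum>h\<in>UNIV. snd r $ (g, h) * (weight_ops t1 t23 t123 g * weight_ops t2 t3 t23 h))"
proof -
  define N where "N = image_algebra \<phi> words_scale words_mult"
  define P where "P = (\<lambda>u. \<phi> (words_diag (t1, t2, t3, t12, t23, t123) (the_inv \<phi> u)))"
  define m where "m = nijenhuis_ops N P"
  define f where "f = (\<lambda>u. words_top (the_inv \<phi> u))"
  interpret binary_algebra N m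
    unfolding m_def N_def P_def by (intro nijenhuis_binary_algebra nijenhuis_words inj t)
  have f: "f (\<phi> a) = words_top a" for a
    using inj by (simp add: f_def the_inv_f_f)
  have minus: "\<ominus>\<^bsub>N\<^esub> \<phi> a = \<phi> (- a)" for a
    unfolding N_def by (rule image_algebra_minus[OF inj vector_space_words])
  have carrier: "carrier N = range \<phi>" by (simp add: N_def image_algebra_def the_inv_f_f)
  have mult: "\<phi> a \<otimes>\<^bsub>N\<^esub> \<phi> b = \<phi> (words_mult a b)" for a b
    using inj by (simp add: N_def image_algebra_def the_inv_f_f)
  have P: "P (\<phi> a) = \<phi> (words_diag (t1, t2, t3, t12, t23, t123) a)" for a
    using inj by (simp add: P_def the_inv_f_f)
  have add: "f (u \<oplus>\<^bsub>N\<^esub> v) = f u + f v" if "u \<in> carrier N" "v \<in> carrier N" for u v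
    using inj by (simp add: f_def N_def image_algebra_def the_inv_f_f words_top_def split: prod.split)
  have scale: "f (c \<odot>\<^bsub>N\<^esub> u) = c * f u" if "u \<in> carrier N" for c u
    using inj by (auto simp: f_def N_def image_algebra_def the_inv_f_f words_top_def words_scale_def
        split: prod.split)
  define x where "x = \<phi> (1, 0, 0, 0, 0, 0)"
  define y where "y = \<phi> (0, 1, 0, 0, 0, 0)"
  define z where "z = \<phi> (0, 0, 1, 0, 0, 0)"
  have xyz: "x \<in> carrier N" "y \<in> carrier N" "z \<in> carrier N"
    by (simp_all add: carrier x_def y_def z_def)
  have L: "f (m h (m g x y) z) = weight_ops t12 t3 t123 h * weight_ops t1 t2 t12 g" for g h
    by (cases g; cases h)
      (simp_all add: m_def nijenhuis_ops_def P mult minus f words_top_def weight_ops_def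
        x_def y_def z_def zero_prod_def)
  have R: "f (m g x (m h y z)) = weight_ops t1 t23 t123 g * weight_ops t2 t3 t23 h" for g h
    by (cases g; cases h)
      (simp_all add: m_def nijenhuis_ops_def P mult minus f words_top_def weight_ops_def
        x_def y_def z_def zero_prod_def)
  have "f (left_value N m (fst r) x y z) = f (right_value N m (snd r) x y z)"
    using sat xyz unfolding satisfies_def m_def N_def P_def by simp
  then show ?thesis
    unfolding left_value_def right_value_def
    by (simp add: additive_functional_finsum[where f = f] add scale xyz op_closed scale_closed
        left_term_closed right_term_closed finsum_closed L R)
qed

section \<open>Relations holding in the diagonal models\<close>

lemma sum_gen: "(\<Sum>g\<in>UNIV. f g) = f Prec + f Succ + f Bullet"
proof -
  have UNIV: "(UNIV :: gen set) = {Prec, Succ, Bullet}" using gen.exhaust by auto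
  show ?thesis unfolding UNIV by (simp add: add.assoc)
qed

text \<open>Each generator has entry 1 at a left coordinate where the other four have 0:
  \<open>Prec Prec\<close>, \<open>Succ Prec\<close>, \<open>Prec Succ\<close>,
  \<open>Prec Bullet\<close>, \<open>Succ Bullet\<close>. These entries of \<open>L\<close> are thus
  forced as the coefficients of \<open>?r\<close>; the equations match the remaining 13
  coordinates.\<close>

lemma nijenhuis_relationsI:
  fixes L S :: "gen \<Rightarrow> gen \<Rightarrow> 'k::field" and r :: "('k, gen) quadratic"
  defines "L \<equiv> \<lambda>g h. fst r $ (g, h)" and "S \<equiv> \<lambda>g h. snd r $ (g, h)"
  assumes "S Prec Prec = L Prec Prec" "S Prec Succ = L Prec Prec" "S Prec Bullet = L Prec Prec"
    "S Succ Prec = L Succ Prec"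
    "S Succ Succ = L Prec Succ" "L Succ Succ = L Prec Succ" "L Bullet Succ = L Prec Succ"
    "S Bullet Succ = L Prec Bullet"
    "S Succ Bullet = L Succ Bullet" "S Bullet Prec = L Succ Bullet" "S Bullet Bullet = L Succ Bullet"
    "L Bullet Prec = L Succ Bullet" "L Bullet Bullet = L Succ Bullet"
  shows "r \<in> nijenhuis_relations"
proof -
  let ?r = "quadratic_scale (L Prec Prec) (basis_tensor Prec Prec, tensor (axis Prec 1) star)
    + quadratic_scale (L Succ Prec) (basis_tensor Succ Prec, basis_tensor Succ Prec)
    + quadratic_scale (L Prec Succ) (tensor star (axis Succ 1), basis_tensor Succ Succ)
    + quadratic_scale (L Prec Bullet) (basis_tensor Prec Bullet, basis_tensor Bullet Succ)
    + quadratic_scale (L Succ Bullet)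
       (basis_tensor Succ Bullet + basis_tensor Bullet Prec + basis_tensor Bullet Bullet,
        basis_tensor Succ Bullet + basis_tensor Bullet Prec + basis_tensor Bullet Bullet)"
  have "fst r $ (g, h) = fst ?r $ (g, h) \<and> snd r $ (g, h) = snd ?r $ (g, h)" for g h
    using assms(3-)
    by (cases g; cases h)
      (auto simp: L_def S_def quadratic_scale_def basis_tensor_def tensor_def star_def axis_def)
  then have "r = ?r"
    by (simp add: prod_eq_iff vec_eq_iff)
  moreover have "?r \<in> nijenhuis_relations"
    unfolding nijenhuis_relations_def
    by (intro quadratic.span_add quadratic.span_scale quadratic.span_base) simp_all
  ultimately show ?thesis by simp
qed

text \<open>Unit vectors give the square coefficients, sums of two unit vectors then the mixed ones.
  Only the values 0 and 1 are inserted, so even the field with two elements is covered.\<close>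

lemma quadratic_form_eq_zero:
  fixes p q r u v w :: "'a::idom"
  assumes "\<And>a b c. p * a * a + q * b * b + r * c * c + u * a * b + v * b * c + w * a * c = 0"
  shows "p = 0" "q = 0" "r = 0" "u = 0" "v = 0" "w = 0"
proof -
  show "p = 0" "q = 0" "r = 0" using assms[of 1 0 0] assms[of 0 1 0] assms[of 0 0 1] by simp_all
  then show "u = 0" "v = 0" "w = 0"
    using assms[of 1 1 0] assms[of 0 1 1] assms[of 1 0 1] by simp_all
qed

lemma relation_in_nijenhuis_relations:
  fixes r :: "('k::field, gen) quadratic"
  assumes "\<And>t1 t2 t3 t12 t23 t123. nijenhuis_weights (t1, t2, t3, t12, t23, t123) \<Longrightarrow>
    (\<Sum>h\<in>UNIV. \<Sum>g\<in>UNIV. fst r $ (g, h) * (weight_ops t12 t3 t123 h * weight_ops t1 t2 t12 g)) =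
    (\<Sum>g\<in>UNIV. \<Sum>h\<in>UNIV. snd r $ (g, h) * (weight_ops t1 t23 t123 g * weight_ops t2 t3 t23 h))"
  shows "r \<in> nijenhuis_relations"
proof -
  define L where "L = (\<lambda>g h. fst r $ (g, h))"
  define S where "S = (\<lambda>g h. snd r $ (g, h))"
  define c1 where "c1 = L Prec Prec - S Prec Succ"
  define c2 where "c2 = L Prec Prec - S Prec Prec"
  define c3 where "c3 = S Prec Bullet - L Prec Prec"
  define c4 where "c4 = L Prec Succ - S Succ Succ"
  define c5 where "c5 = L Succ Succ - S Succ Succ"
  define c6 where "c6 = S Succ Succ - L Bullet Succ"
  define c7 where "c7 = S Bullet Succ - L Prec Bullet"
  define c8 where "c8 = L Succ Prec - S Succ Prec"
  define c9 where "c9 = S Succ Bullet - L Succ Bullet"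
  define c10 where "c10 = S Bullet Prec - L Bullet Prec"
  define c11 where "c11 = L Bullet Bullet - L Bullet Prec"
  define c12 where "c12 = S Succ Bullet - S Bullet Bullet"
  define c13 where "c13 = L Bullet Prec - S Succ Bullet"
  note c_defs = c1_def c2_def c3_def c4_def c5_def c6_def c7_def c8_def c9_def c10_def c11_def
    c12_def c13_def
  have weights: "(\<Sum>h\<in>UNIV. \<Sum>g\<in>UNIV. L g h * (weight_ops t12 t3 t123 h * weight_ops t1 t2 t12 g)) =
      (\<Sum>g\<in>UNIV. \<Sum>h\<in>UNIV. S g h * (weight_ops t1 t23 t123 g * weight_ops t2 t3 t23 h))"
    if "nijenhuis_weights (t1, t2, t3, t12, t23, t123)" for t1 t2 t3 t12 t23 t123
    using assms[OF that] by (simp add: L_def S_def)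
  note expand = sum_gen weight_ops_def c_defs algebra_simps
  txt \<open>\<open>c1, \<dots>, c13\<close> are the coefficients of the left minus the right side, in a free Nijenhuis algebra, at
    \<open>xP(P(y)z)\<close>, \<open>xP(yP(z))\<close>, \<open>xP\<^sup>2(yz)\<close>, \<open>P(xP(y))z\<close>, \<open>P(P(x)y)z\<close>, \<open>P\<^sup>2(xy)z\<close>,
    \<open>P(xP(y)z)\<close>, \<open>P(x)yP(z)\<close>, \<open>P(P(x)yz)\<close>, \<open>P(xyP(z))\<close>, \<open>P(P(xy)z)\<close>,
    \<open>P(xP(yz))\<close>, \<open>P\<^sup>2(xyz)\<close>.\<close>
  have 1: "(c5 + c6 + c9 + c11 + c13) * a * a + (c1 + c3) * b * b + 0 * c * c +
      (c4 + c7 + c12) * a * b + c2 * b * c + (c8 + c10) * a * c = 0" for a b c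
    using weights[of a b c a b a] by (simp add: expand)
  have 2: "(c5 + c6 + c9 + c11 + c13) * a * a + 0 * b * b + (c2 + c3) * c * c +
      (c4 + c7) * a * b + c1 * b * c + (c8 + c10 + c12) * a * c = 0" for a b c
    using weights[of a b c a c a] by (simp add: expand)
  have 3: "(c5 + c6) * a * a + 0 * b * b + (c2 + c3 + c10 + c12 + c13) * c * c +
      c4 * a * b + (c1 + c7) * b * c + (c8 + c9 + c11) * a * c = 0" for a b c
    using weights[of a b c a c c] by (simp add: expand)
  have 4: "0 * a * a + (c4 + c6) * b * b + (c2 + c3 + c10 + c12 + c13) * c * c +
      c5 * a * b + (c1 + c7 + c11) * b * c + (c8 + c9) * a * c = 0" for a b c
    using weights[of a b c b c c] by (simp add: expand)
  have 5: "0 * a * a + (c1 + c3 + c4 + c6 + c7 + c11 + c12 + c13) * b * b + 0 * c * c +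
      (c5 + c9) * a * b + (c2 + c10) * b * c + c8 * a * c = 0" for a b c
    using weights[of a b c b b b] by (simp add: expand)
  \<comment> \<open>These five stand alone as a mixed coefficient: \<open>c1\<close> in 2,
    \<open>c2\<close> in 1, \<open>c4\<close> in 3, \<open>c5\<close> in 4, \<open>c8\<close> in
    5.\<close>
  have "c1 = 0" "c2 = 0" "c4 = 0" "c5 = 0" "c8 = 0"
    by (rule quadratic_form_eq_zero[OF 2] quadratic_form_eq_zero[OF 1]
        quadratic_form_eq_zero[OF 3] quadratic_form_eq_zero[OF 4] quadratic_form_eq_zero[OF 5])+
  \<comment> \<open>The elimination is triangular from here on: each new unknown occurs in some
    coefficient whose other terms are already zero, such as \<open>c1 + c3\<close> for
    \<open>c3\<close>.\<close>
  moreover from this have "c3 = 0" "c6 = 0" "c7 = 0" "c9 = 0" "c10 = 0"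
    using quadratic_form_eq_zero[OF 1] quadratic_form_eq_zero[OF 2]
      quadratic_form_eq_zero[OF 3] quadratic_form_eq_zero[OF 4] by simp_all
  moreover from calculation have "c11 = 0" "c12 = 0"
    using quadratic_form_eq_zero[OF 1] quadratic_form_eq_zero[OF 4] by simp_all
  moreover from calculation have "c13 = 0"
    using quadratic_form_eq_zero[OF 1] by simp
  ultimately show ?thesis
    by (intro nijenhuis_relationsI) (simp_all add: c_defs L_def S_def)
qed

text \<open>Algebras over a smaller \<open>R\<close>, such as \<open>{0}\<close>, can violate the
  five identities. The final assertion of the English statement is therefore rendered by two
  conjuncts: the identities imply \<open>R\<close> exactly when \<open>R\<close> lies in the span,
  and \<open>R\<close> implies them when it contains the span. Type \<open>'n\<close> is large
  enough to hold the test models; the conjuncts over \<open>'m\<close> hold for any carrier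
  type.\<close>

theorem theorem4p2:
  fixes R :: "('k::field, gen) quadratic set"
  assumes "quadratic.subspace R"
    and "infinite (UNIV :: 'n set)"
    and "\<exists>f :: 'k \<Rightarrow> 'n. inj f"
  shows
    "((\<forall>(N :: ('k, 'n) module) P.
          nijenhuis_algebra N P \<longrightarrow> operad_algebra R N (nijenhuis_ops N P))
        \<longleftrightarrow> R \<subseteq> nijenhuis_relations)
     \<and> (R \<subseteq> nijenhuis_relations \<longrightarrow>
          (\<forall>(N :: ('k, 'm) module) P.
            nijenhuis_algebra N P \<longrightarrow> operad_algebra R N (nijenhuis_ops N P)))
     \<and> (R \<subseteq> nijenhuis_relations \<longleftrightarrow>
          (\<forall>(A :: ('k, 'n) module) m.
            binary_algebra A m \<and> nijenhuis_identities A (m Prec) (m Succ) (m Bullet)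
              \<longrightarrow> operad_algebra R A m))
     \<and> (nijenhuis_relations \<subseteq> R \<longrightarrow>
          (\<forall>(A :: ('k, 'm) module) m.
            operad_algebra R A m
              \<longrightarrow> nijenhuis_identities A (m Prec) (m Succ) (m Bullet)))"
proof -
  \<comment> \<open>Shared by both equivalences; the size of \<open>'n\<close> enters here, through
    the injection of the six-dimensional models.\<close>
  have contained: "R \<subseteq> nijenhuis_relations"
    if N: "\<And>(N :: ('k, 'n) module) P. nijenhuis_algebra N P
      \<Longrightarrow> operad_algebra R N (nijenhuis_ops N P)"
  proof
    fix r assume r: "r \<in> R"
    obtain \<phi> :: "'k words \<Rightarrow> 'n" where \<phi>: "inj \<phi>"
      using inj_words[OF assms(2,3)] by blast
    show "r \<in> nijenhuis_relations"
    proof (rule relation_in_nijenhuis_relations, rule satisfies_words[OF \<phi>])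
      fix t1 t2 t3 t12 t23 t123 :: 'k
      assume t: "nijenhuis_weights (t1, t2, t3, t12, t23, t123)"
      note model = nijenhuis_words[OF \<phi> t]
      show "satisfies (image_algebra \<phi> words_scale words_mult)
          (nijenhuis_ops (image_algebra \<phi> words_scale words_mult)
            (\<lambda>u. \<phi> (words_diag (t1, t2, t3, t12, t23, t123) (the_inv \<phi> u)))) r"
        using N[OF model] r
        by (simp add: binary_algebra.operad_algebra_iff[OF nijenhuis_binary_algebra[OF model]])
    qed
  qed
  have identities: "operad_algebra R A m"
    if "R \<subseteq> nijenhuis_relations" "binary_algebra A m"
      "nijenhuis_identities A (m Prec) (m Succ) (m Bullet)"
    for A :: "('k, 'n) module" and m
    using that by (auto simp: binary_algebra.operad_algebra_iff
        satisfies_nijenhuis_relations_iff[symmetric])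
  have "nijenhuis_identities A (m Prec) (m Succ) (m Bullet)"
    if "nijenhuis_relations \<subseteq> R" "operad_algebra R A m" for A :: "('k, 'm) module" and m
  proof -
    have "binary_algebra A m" using that(2) by (simp add: operad_algebra_def)
    then show ?thesis
      using that by (auto simp: binary_algebra.operad_algebra_iff
          satisfies_nijenhuis_relations_iff[symmetric])
  qed
  moreover have "R \<subseteq> nijenhuis_relations
      \<longleftrightarrow> (\<forall>(A :: ('k, 'n) module) m.
        binary_algebra A m \<and> nijenhuis_identities A (m Prec) (m Succ) (m Bullet)
          \<longrightarrow> operad_algebra R A m)"
  proof (intro iffI allI impI)
    assume *: "\<forall>(A :: ('k, 'n) module) m.
      binary_algebra A m \<and> nijenhuis_identities A (m Prec) (m Succ) (m Bullet)
        \<longrightarrow> operad_algebra R A m"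
    \<comment> \<open>Nijenhuis algebras satisfy the five identities, so they are among the algebras
      covered by the hypothesis.\<close>
    show "R \<subseteq> nijenhuis_relations"
      by (rule contained, rule *[rule_format])
        (intro conjI nijenhuis_binary_algebra nijenhuis_algebra.satisfies_nijenhuis_identities)
  qed (use identities in simp)
  moreover have "(\<forall>(N :: ('k, 'n) module) P.
        nijenhuis_algebra N P \<longrightarrow> operad_algebra R N (nijenhuis_ops N P))
      \<longleftrightarrow> R \<subseteq> nijenhuis_relations"
    using contained nijenhuis_operad_algebra by blast
  moreover have "R \<subseteq> nijenhuis_relations \<longrightarrow>
      (\<forall>(N :: ('k, 'm) module) P.
        nijenhuis_algebra N P \<longrightarrow> operad_algebra R N (nijenhuis_ops N P))"
    using nijenhuis_operad_algebra by blast
  ultimately show ?thesis by simp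
qed

end
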